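(* Let $|\psi\rangle$ (target) and $|\phi\rangle$ (seed) be bipartite pure states. Unless the seed state is, up to local unitaries (with local spaces identified/embedded via local isometries), of the form $|\phi\rangle=|\psi\rangle\otimes|\zeta\rangle$ for some bipartite pure state $|\zeta\rangle$, there exists $\varepsilon>0$ such that there do not exist local operations that take $|\phi\rangle$ to $|\psi\rangle$ up to error $\varepsilon$; that is, there are no local quantum channels $\mathcal E,\mathcal F$ with $F\bigl(|\psi\rangle\langle\psi|,(\mathcal E\otimes\mathcal F)(|\phi\rangle\langle\phi|)\bigr)\ge1-\varepsilon$.
   Context: States are finite-dimensional. $|\psi\rangle\in A\otimes B$, $|\zeta\rangle\in A'\otimes B'$ and $|\psi\rangle\otimes|\zeta\rangle$ is regarded as bipartite across $AA'$ versus $BB'$. Fidelity with a pure state: $F(|\psi\rangle\langle\psi|,\sigma)=\langle\psi|\sigma|\psi\rangle$. Quantum channels are completely positive trace-preserving maps; $\mathcal E$ acts on Alice's part, $\mathcal F$ on Bob's part. *)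

theory Defs
  imports "Jordan_Normal_Form.Schur_Decomposition"
begin

text \<open>
  A finite-dimensional Hilbert space of dimension \<open>n\<close> is \<open>carrier_vec n\<close> over the complex numbers,
  and operators on it are \<open>carrier_mat n n\<close>.  In a tensor product of spaces of dimensions \<open>m\<close> and
  \<open>n\<close>, the basis vector \<open>e_i \<otimes> e_j\<close> carries the index \<open>i * n + j\<close> (the Kronecker convention).
  Since \<open>v \<bullet>c w\<close> conjugates its second argument, \<open>\<langle>w|v\<rangle>\<close> is \<open>v \<bullet>c w\<close>.
\<close>

definition tensor_vec :: "complex vec \<Rightarrow> complex vec \<Rightarrow> complex vec" where
  "tensor_vec u v = vec (dim_vec u * dim_vec v) (\<lambda>i. u $ (i div dim_vec v) * v $ (i mod dim_vec v))"

definition tensor_mat :: "complex mat \<Rightarrow> complex mat \<Rightarrow> complex mat" where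
  "tensor_mat M N = mat (dim_row M * dim_row N) (dim_col M * dim_col N)
     (\<lambda>(r, s). M $$ (r div dim_row N, s div dim_col N) * N $$ (r mod dim_row N, s mod dim_col N))"

definition bipartite_pure_state :: "nat \<Rightarrow> nat \<Rightarrow> complex vec \<Rightarrow> bool" where
  "bipartite_pure_state a b \<psi> \<longleftrightarrow> \<psi> \<in> carrier_vec (a * b) \<and> \<psi> \<bullet>c \<psi> = 1"

text \<open>
  For \<open>\<psi>\<close> in \<open>A \<otimes> B\<close> and \<open>\<zeta>\<close> in \<open>A' \<otimes> B'\<close>, this is \<open>\<psi> \<otimes> \<zeta>\<close> with its tensor factors reordered from
  \<open>A B A' B'\<close> to \<open>(A A') (B B')\<close>, that is, viewed as bipartite across \<open>A A'\<close> versus \<open>B B'\<close>.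
\<close>

definition bipartite_tensor ::
    "nat \<Rightarrow> nat \<Rightarrow> nat \<Rightarrow> nat \<Rightarrow> complex vec \<Rightarrow> complex vec \<Rightarrow> complex vec" where
  "bipartite_tensor a b a' b' \<psi> \<zeta> = vec ((a * a') * (b * b')) (\<lambda>r.
     let x = r div (b * b'); y = r mod (b * b') in
     \<psi> $ ((x div a') * b + y div b') * \<zeta> $ ((x mod a') * b' + y mod b'))"

definition isometry :: "nat \<Rightarrow> nat \<Rightarrow> complex mat \<Rightarrow> bool" where
  "isometry m n V \<longleftrightarrow> V \<in> carrier_mat n m \<and> mat_adjoint V * V = 1\<^sub>m m"

text \<open>
  \<open>\<phi>\<close>, on spaces of dimensions \<open>c\<close> and \<open>d\<close>, becomes \<open>\<psi> \<otimes> \<zeta>\<close> for some pure state \<open>\<zeta>\<close> after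
  embedding Alice's space into \<open>A A'\<close> and Bob's into \<open>B B'\<close> by isometries.  The dimensions of \<open>A'\<close>
  and \<open>B'\<close> are arbitrary; when \<open>c\<close> equals \<open>a * a'\<close> and \<open>d\<close> equals \<open>b * b'\<close> the isometries are
  local unitaries.
\<close>

definition locally_contains ::
    "nat \<Rightarrow> nat \<Rightarrow> complex vec \<Rightarrow> nat \<Rightarrow> nat \<Rightarrow> complex vec \<Rightarrow> bool" where
  "locally_contains c d \<phi> a b \<psi> \<longleftrightarrow>
     (\<exists>a' b' \<zeta> V W. bipartite_pure_state a' b' \<zeta> \<and>
        isometry c (a * a') V \<and> isometry d (b * b') W \<and>
        tensor_mat V W *\<^sub>v \<phi> = bipartite_tensor a b a' b' \<psi> \<zeta>)"

definition mat_trace :: "complex mat \<Rightarrow> complex" where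
  "mat_trace M = (\<Sum>i<dim_row M. M $$ (i, i))"

text \<open>
  With the order on the complex numbers, \<open>0 \<le> z\<close> says that \<open>z\<close> is real and nonnegative, so
  Hermiticity is implied.
\<close>

definition psd :: "nat \<Rightarrow> complex mat \<Rightarrow> bool" where
  "psd n M \<longleftrightarrow> M \<in> carrier_mat n n \<and> (\<forall>v \<in> carrier_vec n. 0 \<le> (M *\<^sub>v v) \<bullet>c v)"

definition density_of :: "complex vec \<Rightarrow> complex mat" where
  "density_of \<phi> = mat (dim_vec \<phi>) (dim_vec \<phi>) (\<lambda>(r, s). \<phi> $ r * cnj (\<phi> $ s))"

definition pure_fidelity :: "complex vec \<Rightarrow> complex mat \<Rightarrow> real" where
  "pure_fidelity \<psi> \<sigma> = Re ((\<sigma> *\<^sub>v \<psi>) \<bullet>c \<psi>)"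

definition linear_map :: "nat \<Rightarrow> nat \<Rightarrow> (complex mat \<Rightarrow> complex mat) \<Rightarrow> bool" where
  "linear_map m n \<E> \<longleftrightarrow>
     (\<forall>X \<in> carrier_mat m m. \<E> X \<in> carrier_mat n n) \<and>
     (\<forall>X \<in> carrier_mat m m. \<forall>Y \<in> carrier_mat m m. \<E> (X + Y) = \<E> X + \<E> Y) \<and>
     (\<forall>k. \<forall>X \<in> carrier_mat m m. \<E> (k \<cdot>\<^sub>m X) = k \<cdot>\<^sub>m \<E> X)"

definition mat_unit :: "nat \<Rightarrow> nat \<Rightarrow> nat \<Rightarrow> complex mat" where
  "mat_unit n i j = mat n n (\<lambda>p. if p = (i, j) then 1 else 0)"

text \<open>
  The tensor product of \<open>\<E>\<close>, from operators in dimension \<open>c\<close> to dimension \<open>a\<close>, and \<open>\<F>\<close>, from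
  dimension \<open>d\<close> to dimension \<open>b\<close>: expand the argument in the basis of the products of matrix units
  \<open>E_ij \<otimes> E_kl\<close> and extend \<open>E_ij \<otimes> E_kl \<mapsto> \<E> E_ij \<otimes> \<F> E_kl\<close> linearly.  The characteristic
  property is lemma \<open>tensor_map_tensor_mat\<close> below.
\<close>

definition tensor_map :: "nat \<Rightarrow> nat \<Rightarrow> nat \<Rightarrow> nat \<Rightarrow>
    (complex mat \<Rightarrow> complex mat) \<Rightarrow> (complex mat \<Rightarrow> complex mat) \<Rightarrow> complex mat \<Rightarrow> complex mat" where
  "tensor_map c a d b \<E> \<F> X = mat (a * b) (a * b) (\<lambda>p.
     \<Sum>i<c. \<Sum>j<c. \<Sum>k<d. \<Sum>l<d.
       X $$ (i * d + k, j * d + l) * tensor_mat (\<E> (mat_unit c i j)) (\<F> (mat_unit d k l)) $$ p)"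

definition completely_positive :: "nat \<Rightarrow> nat \<Rightarrow> (complex mat \<Rightarrow> complex mat) \<Rightarrow> bool" where
  "completely_positive m n \<E> \<longleftrightarrow>
     (\<forall>k X. psd (k * m) X \<longrightarrow> psd (k * n) (tensor_map k k m n (\<lambda>Y. Y) \<E> X))"

definition trace_preserving :: "nat \<Rightarrow> (complex mat \<Rightarrow> complex mat) \<Rightarrow> bool" where
  "trace_preserving m \<E> \<longleftrightarrow> (\<forall>X \<in> carrier_mat m m. mat_trace (\<E> X) = mat_trace X)"

definition quantum_channel :: "nat \<Rightarrow> nat \<Rightarrow> (complex mat \<Rightarrow> complex mat) \<Rightarrow> bool" where
  "quantum_channel m n \<E> \<longleftrightarrow>
     linear_map m n \<E> \<and> completely_positive m n \<E> \<and> trace_preserving m \<E>"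

lemma index_pair_less:
  fixes i k c d :: nat
  assumes "i < c" "k < d"
  shows "i * d + k < c * d"
proof -
  have "i * d + k < Suc i * d" using assms by simp
  also have "\<dots> \<le> c * d" using assms by (intro mult_le_mono1) simp
  finally show ?thesis .
qed

lemma index_div_less: "r < a * b \<Longrightarrow> r div b < (a::nat)"
  by (simp add: less_mult_imp_div_less)

lemma index_mod_less: "r < a * b \<Longrightarrow> r mod b < (b::nat)"
  by (cases "b = 0") auto

lemma linear_map_expand:
  assumes lin: "linear_map c a \<E>" and X: "X \<in> carrier_mat c c" and rs: "r < a" "s < a"
  shows "\<E> X $$ (r, s) = (\<Sum>i<c. \<Sum>j<c. X $$ (i, j) * \<E> (mat_unit c i j) $$ (r, s))"
proof -
  let ?P = "\<lambda>S. mat c c (\<lambda>p. if p \<in> S then X $$ p else 0)"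
  have part: "\<E> (?P S) $$ (r, s) = (\<Sum>(i, j)\<in>S. X $$ (i, j) * \<E> (mat_unit c i j) $$ (r, s))"
    if "finite S" "S \<subseteq> {..<c} \<times> {..<c}" for S
    using that
  proof (induction S rule: finite_induct)
    case empty
    have z: "?P {} = 0 \<cdot>\<^sub>m X" using X by (intro eq_matI) auto
    have "\<E> X \<in> carrier_mat a a" using lin X by (auto simp: linear_map_def)
    moreover have "\<E> (?P {}) = 0 \<cdot>\<^sub>m \<E> X"
      unfolding z using lin X by (auto simp: linear_map_def)
    ultimately show ?case using rs by simp
  next
    case (insert q S)
    obtain i j where q: "q = (i, j)" by (cases q)
    have e: "?P (insert q S) = X $$ (i, j) \<cdot>\<^sub>m mat_unit c i j + ?P S"
      using insert.hyps(2) q by (intro eq_matI) (auto simp: mat_unit_def)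
    have mu: "mat_unit c i j \<in> carrier_mat c c" by (simp add: mat_unit_def)
    have "\<E> (?P (insert q S)) = X $$ (i, j) \<cdot>\<^sub>m \<E> (mat_unit c i j) + \<E> (?P S)"
      unfolding e using lin mu by (simp add: linear_map_def)
    moreover have "\<E> (mat_unit c i j) \<in> carrier_mat a a" "\<E> (?P S) \<in> carrier_mat a a"
      using lin mu by (auto simp: linear_map_def)
    ultimately have "\<E> (?P (insert q S)) $$ (r, s)
        = X $$ (i, j) * \<E> (mat_unit c i j) $$ (r, s) + \<E> (?P S) $$ (r, s)"
      using rs by simp
    then show ?case using insert q by simp
  qed
  have "X = ?P ({..<c} \<times> {..<c})" using X by (intro eq_matI) auto
  then show ?thesis
    using part[of "{..<c} \<times> {..<c}"] by (simp add: sum.cartesian_product)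
qed

lemma tensor_map_tensor_mat:
  assumes E: "linear_map c a \<E>" and F: "linear_map d b \<F>"
    and X: "X \<in> carrier_mat c c" and Y: "Y \<in> carrier_mat d d"
  shows "tensor_map c a d b \<E> \<F> (tensor_mat X Y) = tensor_mat (\<E> X) (\<F> Y)"
proof (rule eq_matI)
  have EX: "\<E> X \<in> carrier_mat a a" and FY: "\<F> Y \<in> carrier_mat b b"
    using E F X Y by (auto simp: linear_map_def)
  show "dim_row (tensor_map c a d b \<E> \<F> (tensor_mat X Y)) = dim_row (tensor_mat (\<E> X) (\<F> Y))"
    "dim_col (tensor_map c a d b \<E> \<F> (tensor_mat X Y)) = dim_col (tensor_mat (\<E> X) (\<F> Y))"
    using EX FY by (auto simp: tensor_map_def tensor_mat_def)
  fix r s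
  assume "r < dim_row (tensor_mat (\<E> X) (\<F> Y))" "s < dim_col (tensor_mat (\<E> X) (\<F> Y))"
  then have r: "r < a * b" and s: "s < a * b" using EX FY by (auto simp: tensor_mat_def)
  let ?e = "\<lambda>i j. \<E> (mat_unit c i j) $$ (r div b, s div b)"
  let ?f = "\<lambda>k l. \<F> (mat_unit d k l) $$ (r mod b, s mod b)"
  have unit: "tensor_mat (\<E> (mat_unit c i j)) (\<F> (mat_unit d k l)) $$ (r, s) = ?e i j * ?f k l"
    for i j k l
  proof -
    have "\<E> (mat_unit c i j) \<in> carrier_mat a a" "\<F> (mat_unit d k l) \<in> carrier_mat b b"
      using E F by (auto simp: linear_map_def mat_unit_def)
    then show ?thesis using r s by (auto simp: tensor_mat_def)
  qed
  have entry: "tensor_mat X Y $$ (i * d + k, j * d + l) = X $$ (i, j) * Y $$ (k, l)"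
    if "i < c" "j < c" "k < d" "l < d" for i j k l
    using that X Y index_pair_less[of i c k d] index_pair_less[of j c l d]
    by (auto simp: tensor_mat_def)
  have "tensor_map c a d b \<E> \<F> (tensor_mat X Y) $$ (r, s)
      = (\<Sum>i<c. \<Sum>j<c. \<Sum>k<d. \<Sum>l<d. (X $$ (i, j) * ?e i j) * (Y $$ (k, l) * ?f k l))"
    using r s by (auto simp: tensor_map_def unit entry intro!: sum.cong)
  also have "\<dots> = (\<Sum>i<c. \<Sum>j<c. (X $$ (i, j) * ?e i j) * (\<Sum>k<d. \<Sum>l<d. Y $$ (k, l) * ?f k l))"
    by (simp only: sum_distrib_left)
  also have "\<dots> = (\<Sum>i<c. \<Sum>j<c. X $$ (i, j) * ?e i j) * (\<Sum>k<d. \<Sum>l<d. Y $$ (k, l) * ?f k l)"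
    by (simp only: sum_distrib_right)
  also have "\<dots> = \<E> X $$ (r div b, s div b) * \<F> Y $$ (r mod b, s mod b)"
    using linear_map_expand[OF E X] linear_map_expand[OF F Y] r s
    by (simp add: index_div_less index_mod_less)
  also have "\<dots> = tensor_mat (\<E> X) (\<F> Y) $$ (r, s)"
    using EX FY r s by (auto simp: tensor_mat_def)
  finally show "tensor_map c a d b \<E> \<F> (tensor_mat X Y) $$ (r, s) = tensor_mat (\<E> X) (\<F> Y) $$ (r, s)" .
qed

lemma bipartite_tensor_product:
  assumes "u \<in> carrier_vec a" "v \<in> carrier_vec b" "u' \<in> carrier_vec a'" "v' \<in> carrier_vec b'"
  shows "bipartite_tensor a b a' b' (tensor_vec u v) (tensor_vec u' v')
       = tensor_vec (tensor_vec u u') (tensor_vec v v')"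
proof (rule eq_vecI)
  show "dim_vec (bipartite_tensor a b a' b' (tensor_vec u v) (tensor_vec u' v'))
      = dim_vec (tensor_vec (tensor_vec u u') (tensor_vec v v'))"
    using assms by (simp add: bipartite_tensor_def tensor_vec_def)
  fix r assume "r < dim_vec (tensor_vec (tensor_vec u u') (tensor_vec v v'))"
  then have r: "r < (a * a') * (b * b')" using assms by (simp add: tensor_vec_def)
  define x y where xy: "x = r div (b * b')" "y = r mod (b * b')"
  have x: "x < a * a'" and y: "y < b * b'"
    using r index_div_less index_mod_less unfolding xy by blast+
  note b = index_div_less[OF x] index_mod_less[OF x] index_div_less[OF y] index_mod_less[OF y]
  show "bipartite_tensor a b a' b' (tensor_vec u v) (tensor_vec u' v') $ r
      = tensor_vec (tensor_vec u u') (tensor_vec v v') $ r"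
    using assms r x y b index_pair_less[OF b(1) b(3)] index_pair_less[OF b(2) b(4)]
    by (simp add: bipartite_tensor_def tensor_vec_def Let_def flip: xy)
qed

end

theory Submission
  imports Defs
begin

text \<open>
  Dilate the channels to local isometries \<open>V\<close> and \<open>W\<close> whose environments \<open>A'\<close> and \<open>B'\<close> have
  fixed dimension.  The fidelity with \<open>\<psi>\<close> is then the squared norm of the part of
  \<open>(V \<otimes> W) \<phi>\<close> that lies in \<open>\<psi> \<otimes> A' \<otimes> B'\<close>.  Isometries of fixed dimensions form a compact set,
  so if the fidelity could be brought arbitrarily close to 1, some \<open>V\<close> and \<open>W\<close> would attain it.
  For these the unit vector \<open>(V \<otimes> W) \<phi>\<close> lies entirely in \<open>\<psi> \<otimes> A' \<otimes> B'\<close>, hence equals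
  \<open>\<psi> \<otimes> \<zeta>\<close>.
\<close>

section \<open>Positive semidefinite matrices\<close>

text \<open>Matrix and vector are plain functions, so the induction on the size can truncate the
  matrix and update a vector without carrier conditions.\<close>

definition herm_form :: "nat \<Rightarrow> (nat \<Rightarrow> nat \<Rightarrow> complex) \<Rightarrow> (nat \<Rightarrow> complex) \<Rightarrow> complex" where
  "herm_form n M v = (\<Sum>i<n. \<Sum>j<n. M i j * v j * cnj (v i))"

lemma herm_form_single:
  assumes "i < n"
  shows "herm_form n M (\<lambda>k. if k = i then x else 0) = M i i * x * cnj x"
proof -
  have "herm_form n M (\<lambda>k. if k = i then x else 0)
      = (\<Sum>k\<in>{i}. \<Sum>l\<in>{i}. M k l * (if l = i then x else 0) * cnj (if k = i then x else 0))"
    unfolding herm_form_def using assms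
    by (intro sum.mono_neutral_cong_right) (auto intro!: sum.mono_neutral_right)
  then show ?thesis by simp
qed

lemma herm_form_two:
  assumes "i < n" "j < n" "i \<noteq> j"
  shows "herm_form n M (\<lambda>k. if k = i then x else if k = j then y else 0)
    = M i i * x * cnj x + M i j * y * cnj x + M j i * x * cnj y + M j j * y * cnj y"
proof -
  let ?v = "\<lambda>k. if k = i then x else if k = j then y else 0"
  have "herm_form n M ?v = (\<Sum>k\<in>{i, j}. \<Sum>l\<in>{i, j}. M k l * ?v l * cnj (?v k))"
    unfolding herm_form_def using assms
    by (intro sum.mono_neutral_cong_right) (auto intro!: sum.mono_neutral_right)
  then show ?thesis using assms by (simp add: algebra_simps)
qed

lemma herm_form_nonneg_diag:
  assumes "\<And>v. 0 \<le> herm_form n M v" and "i < n"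
  shows "0 \<le> M i i"
  using assms(1)[of "\<lambda>k. if k = i then 1 else 0"] herm_form_single[OF assms(2), of M 1] by simp

text \<open>Polarisation: nonnegative values are real, and vanishing imaginary parts at
  \<open>e_i + e_j\<close> and \<open>e_i + \<i> e_j\<close> relate the imaginary and the real parts
  of the two entries.\<close>

lemma herm_form_nonneg_hermitian:
  assumes pos: "\<And>v. 0 \<le> herm_form n M v" and ij: "i < n" "j < n"
  shows "M j i = cnj (M i j)"
proof (cases "i = j")
  case True
  then show ?thesis
    using herm_form_nonneg_diag[of n M i] pos ij by (simp add: less_eq_complex_def complex_eq_iff)
next
  case False
  have q: "0 \<le> M i i * x * cnj x + M i j * y * cnj x + M j i * x * cnj y + M j j * y * cnj y" for x y
    using pos[of "\<lambda>k. if k = i then x else if k = j then y else 0"] herm_form_two[OF ij False, of M x y]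
    by simp
  have d: "Im (M i i) = 0" "Im (M j j) = 0"
    using herm_form_nonneg_diag[of n M] pos ij by (simp_all add: less_eq_complex_def)
  show ?thesis
    using q[of 1 1] q[of 1 \<i>] d by (simp add: less_eq_complex_def complex_eq_iff)
qed

text \<open>With no quadratic term in direction \<open>j\<close>, a nonzero \<open>M i j\<close>
  would leave a linear term that drives the form below zero.\<close>

lemma herm_form_nonneg_zero_diag:
  assumes pos: "\<And>v. 0 \<le> herm_form n M v" and ij: "i < n" "j < n" and z: "M j j = 0"
  shows "M i j = 0"
proof (rule ccontr)
  assume nz: "M i j \<noteq> 0"
  with z have ne: "i \<noteq> j" by auto
  \<comment> \<open>Chosen so that the form at the test vector is exactly -1.\<close>
  define s where "s = (Re (M i i) + 1) / (2 * (cmod (M i j))\<^sup>2)"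
  have "0 \<le> herm_form n M (\<lambda>k. if k = i then 1 else if k = j then - s * cnj (M i j) else 0)"
    by (rule pos)
  then have "0 \<le> Re (M i i - 2 * of_real s * (M i j * cnj (M i j)))"
    unfolding herm_form_two[OF ij ne] herm_form_nonneg_hermitian[OF pos ij]
    by (simp add: z less_eq_complex_def algebra_simps)
  also have "\<dots> = Re (M i i) - 2 * s * (cmod (M i j))\<^sup>2"
    unfolding complex_norm_square[symmetric] by simp
  also have "\<dots> = -1" using nz by (simp add: s_def) (simp add: field_simps)
  finally show False by simp
qed

text \<open>Induction on the size; the step splits off the last row and column by a Schur complement.
  If the last diagonal entry is zero, so are its row and column, and dividing by it harmlessly
  yields 0.\<close>

lemma herm_form_nonneg_rank_one_sum:
  assumes "\<And>v. 0 \<le> herm_form n M v"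
  shows "\<exists>B. \<forall>i<n. \<forall>j<n. M i j = (\<Sum>k<n. B k i * cnj (B k j))"
  using assms
proof (induction n arbitrary: M)
  case 0
  then show ?case by simp
next
  case (Suc n)
  define m where "m = Re (M n n)"
  have m: "M n n = of_real m" "0 \<le> m"
    using herm_form_nonneg_diag[OF Suc.prems, of n] by (simp_all add: m_def less_eq_complex_def complex_eq_iff)
  have herm: "M j i = cnj (M i j)" if "i \<le> n" "j \<le> n" for i j
    by (rule herm_form_nonneg_hermitian[OF Suc.prems]) (use that in simp_all)
  have zero: "M i n = 0" "M n i = 0" if "m = 0" "i \<le> n" for i
  proof -
    show "M i n = 0"
      using herm_form_nonneg_zero_diag[OF Suc.prems, of i n] that m by simp
    then show "M n i = 0" using herm[of i n] that by simp
  qed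
  define M' where "M' = (\<lambda>i j. M i j - M i n * M n j / of_real m)"
  have "0 \<le> herm_form n M' v" for v
  proof -
    define w where "w = (\<Sum>j<n. M n j * v j)"
    \<comment> \<open>For \<open>m > 0\<close> this last coordinate minimises the form of
      \<open>M\<close> among the extensions of \<open>v\<close>, and the minimum is the form of
      \<open>M'\<close> at \<open>v\<close>. For \<open>m = 0\<close> it is 0.\<close>
    define t where "t = - w / of_real m"
    define v' where "v' = v(n := t)"
    have w0: "w = 0" if "m = 0" unfolding w_def using zero[OF that] by simp
    have cw: "cnj w = (\<Sum>i<n. M i n * cnj (v i))"
    proof -
      have "cnj (M n i * v i) = M i n * cnj (v i)" if "i < n" for i
        using herm[of n i] that by simp
      then show ?thesis unfolding w_def cnj_sum by (intro sum.cong) auto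
    qed
    have "herm_form (Suc n) M v' = herm_form n M v + (\<Sum>i<n. M i n * t * cnj (v i))
        + (\<Sum>j<n. M n j * v j * cnj t) + M n n * t * cnj t"
      by (simp add: herm_form_def v'_def sum.distrib)
    also have "(\<Sum>i<n. M i n * t * cnj (v i)) = t * cnj w"
      unfolding cw sum_distrib_left by (simp add: ac_simps)
    also have "(\<Sum>j<n. M n j * v j * cnj t) = w * cnj t"
      unfolding w_def sum_distrib_right ..
    also have "herm_form n M v + t * cnj w + w * cnj t + M n n * t * cnj t
        = herm_form n M v - cnj w * w / of_real m"
    proof (cases "m = 0")
      case True
      then show ?thesis using w0 m by simp
    next
      case False
      then have "t * cnj w = - (cnj w * w / of_real m)" "w * cnj t = - (cnj w * w / of_real m)"
        "M n n * t * cnj t = cnj w * w / of_real m"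
        unfolding t_def m by simp_all
      then show ?thesis by simp
    qed
    also have "cnj w * w / of_real m = (\<Sum>i<n. \<Sum>j<n. M i n * M n j / of_real m * v j * cnj (v i))"
      unfolding cw unfolding w_def sum_product sum_divide_distrib
      by (intro sum.cong refl) simp
    also have "herm_form n M v - \<dots> = herm_form n M' v"
      unfolding herm_form_def M'_def sum_subtractf[symmetric] left_diff_distrib ..
    finally show ?thesis using Suc.prems[of v'] by simp
  qed
  then obtain B where B: "\<And>i j. i < n \<Longrightarrow> j < n \<Longrightarrow> M' i j = (\<Sum>k<n. B k i * cnj (B k j))"
    using Suc.IH[of M'] by blast
  \<comment> \<open>The old vectors are padded by 0 at index \<open>n\<close>. The new one is the
    last column of \<open>M\<close> scaled so that its rank-one matrix restores what
    \<open>M'\<close> subtracts.\<close>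
  define B' where "B' = (\<lambda>k i. if k < n then if i < n then B k i else 0 else M i n / of_real (sqrt m))"
  have sq: "of_real (sqrt m) * of_real (sqrt m) = complex_of_real m"
    using m(2) by (simp flip: of_real_mult)
  have "M i j = (\<Sum>k<Suc n. B' k i * cnj (B' k j))" if "i < Suc n" "j < Suc n" for i j
  proof -
    have "(\<Sum>k<Suc n. B' k i * cnj (B' k j))
        = (\<Sum>k<n. B' k i * cnj (B' k j)) + M i n * M n j / of_real m"
      using herm[of j n] that by (simp add: B'_def sq)
    also have "\<dots> = M i j"
    proof (cases "i < n \<and> j < n")
      case True
      then show ?thesis using B[of i j, symmetric] by (simp add: B'_def) (simp add: M'_def)
    next
      case False
      then have "i = n \<or> j = n" using that by auto
      moreover have "(\<Sum>k<n. B' k i * cnj (B' k j)) = 0" using False by (auto simp: B'_def)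
      ultimately show ?thesis using zero[of i] zero[of j] that m by (cases "m = 0") auto
    qed
    finally show ?thesis by simp
  qed
  then show ?case by blast
qed

text \<open>Applied to a Choi matrix, this produces the Kraus operators, flattened to
  vectors.\<close>

lemma psd_rank_one_sum:
  assumes "psd n X"
  shows "\<exists>B. \<forall>i<n. \<forall>j<n. X $$ (i, j) = (\<Sum>k<n. B k i * cnj (B k j))"
proof (rule herm_form_nonneg_rank_one_sum)
  fix v
  have X: "X \<in> carrier_mat n n" using assms by (simp add: psd_def)
  have "(X *\<^sub>v vec n v) \<bullet>c vec n v = herm_form n (\<lambda>i j. X $$ (i, j)) v"
    using X by (simp add: scalar_prod_def herm_form_def atLeast0LessThan sum_distrib_right)
  then show "0 \<le> herm_form n (\<lambda>i j. X $$ (i, j)) v"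
    using assms by (metis psd_def vec_carrier)
qed

lemma psd_density_of: "psd (dim_vec \<phi>) (density_of \<phi>)"
  unfolding psd_def
proof (intro conjI ballI)
  show "density_of \<phi> \<in> carrier_mat (dim_vec \<phi>) (dim_vec \<phi>)" by (simp add: density_of_def)
  fix v :: "complex vec" assume v: "v \<in> carrier_vec (dim_vec \<phi>)"
  define z where "z = (\<Sum>i<dim_vec \<phi>. \<phi> $ i * cnj (v $ i))"
  have "(density_of \<phi> *\<^sub>v v) \<bullet>c v
      = (\<Sum>i<dim_vec \<phi>. \<Sum>j<dim_vec \<phi>. \<phi> $ i * cnj (v $ i) * cnj (\<phi> $ j * cnj (v $ j)))"
    using v by (simp add: density_of_def scalar_prod_def atLeast0LessThan sum_distrib_left sum_distrib_right ac_simps)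
  also have "\<dots> = z * cnj z"
    unfolding z_def cnj_sum sum_product ..
  finally show "0 \<le> (density_of \<phi> *\<^sub>v v) \<bullet>c v" by (simp add: less_eq_complex_def)
qed

lemma sum_lessThan_mult:
  fixes f :: "nat \<Rightarrow> 'a::comm_monoid_add"
  shows "(\<Sum>x<m * n. f x) = (\<Sum>i<m. \<Sum>j<n. f (i * n + j))"
proof -
  have "(\<Sum>x<m * n. f x) = (\<Sum>(i, j)\<in>{..<m} \<times> {..<n}. f (i * n + j))"
    by (rule sum.reindex_bij_witness[of _ "\<lambda>(i, j). i * n + j" "\<lambda>x. (x div n, x mod n)"])
      (auto simp: index_div_less index_mod_less index_pair_less)
  then show ?thesis by (simp add: sum.cartesian_product)
qed

section \<open>Isometries and dilations\<close>

text \<open>Orthonormality of the columns, in an entrywise form that can be read off from trace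
  preservation and that passes to entrywise limits.\<close>

lemma isometry_iff:
  "isometry m n V \<longleftrightarrow> V \<in> carrier_mat n m \<and>
    (\<forall>i<m. \<forall>j<m. (\<Sum>x<n. V $$ (x, i) * cnj (V $$ (x, j))) = (if i = j then 1 else 0))"
proof (cases "V \<in> carrier_mat n m")
  case True
  have entry: "(mat_adjoint V * V) $$ (j, i) = (\<Sum>x<n. V $$ (x, i) * cnj (V $$ (x, j)))"
    if "i < m" "j < m" for i j
    using that True
    by (auto simp: mat_adjoint_def mat_of_rows_def scalar_prod_def atLeast0LessThan ac_simps intro!: sum.cong)
  have dim: "mat_adjoint V * V \<in> carrier_mat m m" 
    using True by (intro mult_carrier_mat[of _ m n]) (auto simp: mat_adjoint_def mat_of_rows_def)
  have "mat_adjoint V * V = 1\<^sub>m m \<longleftrightarrow> (\<forall>i<m. \<forall>j<m. (mat_adjoint V * V) $$ (j, i) = 1\<^sub>m m $$ (j, i))"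
    using dim by (metis carrier_matD eq_matI index_one_mat(2,3))
  then show ?thesis unfolding isometry_def using True entry by auto
next
  case False
  then show ?thesis by (simp add: isometry_def)
qed

text \<open>The unnormalised maximally entangled vector, whose image under \<open>id \<otimes> \<E>\<close> is the Choi
  matrix of \<open>\<E>\<close>.\<close>

definition max_ent :: "nat \<Rightarrow> complex vec" where
  "max_ent c = vec (c * c) (\<lambda>r. if r div c = r mod c then 1 else 0)"

lemma choi_matrix_entry:
  assumes E: "linear_map c a \<E>" and pq: "p < c" "q < c" and rs: "r < a" "s < a"
  shows "tensor_map c c c a (\<lambda>Y. Y) \<E> (density_of (max_ent c)) $$ (p * a + r, q * a + s)
    = \<E> (mat_unit c p q) $$ (r, s)"
proof -
  let ?Z = "\<E> (mat_unit c p q) $$ (r, s)"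
  have X: "density_of (max_ent c) $$ (i * c + k, j * c + l) = (if i = k \<and> j = l then 1 else 0)"
    if "i < c" "j < c" "k < c" "l < c" for i j k l
    using that index_pair_less[of i c k c] index_pair_less[of j c l c]
    by (simp add: density_of_def max_ent_def)
  have T: "tensor_mat (mat_unit c i j) (\<E> (mat_unit c k l)) $$ (p * a + r, q * a + s)
      = (if i = p \<and> j = q then \<E> (mat_unit c k l) $$ (r, s) else 0)" for i j k l
  proof -
    have "\<E> (mat_unit c k l) \<in> carrier_mat a a"
      using E by (auto simp: linear_map_def mat_unit_def)
    then show ?thesis
      using pq rs index_pair_less[of p c r a] index_pair_less[of q c s a]
      by (auto simp: tensor_mat_def mat_unit_def)
  qed
  have "tensor_map c c c a (\<lambda>Y. Y) \<E> (density_of (max_ent c)) $$ (p * a + r, q * a + s)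
      = (\<Sum>i<c. \<Sum>j<c. \<Sum>k<c. \<Sum>l<c. density_of (max_ent c) $$ (i * c + k, j * c + l)
          * tensor_mat (mat_unit c i j) (\<E> (mat_unit c k l)) $$ (p * a + r, q * a + s))"
    using pq rs index_pair_less[of p c r a] index_pair_less[of q c s a] by (simp add: tensor_map_def)
  \<comment> \<open>The tests are nested with the innermost summation index outermost, so that the
    sums collapse one after another.\<close>
  also have "\<dots> = (\<Sum>i<c. \<Sum>j<c. \<Sum>k<c. \<Sum>l<c.
          if l = q then if k = p then if j = q then if i = p then ?Z else 0 else 0 else 0 else 0)"
    by (intro sum.cong refl) (auto simp: X T)
  finally show ?thesis using pq by simp
qed

text \<open>The Stinespring dilation of a channel; the index of the environment is its second factor.\<close>

lemma quantum_channel_dilation: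
  assumes "quantum_channel c a \<E>"
  shows "\<exists>V. isometry c (a * (c * a)) V \<and>
    (\<forall>i<c. \<forall>j<c. \<forall>r<a. \<forall>s<a. \<E> (mat_unit c i j) $$ (r, s)
      = (\<Sum>m<c * a. V $$ (r * (c * a) + m, i) * cnj (V $$ (s * (c * a) + m, j))))"
proof -
  have E: "linear_map c a \<E>" and cp: "completely_positive c a \<E>" and tp: "trace_preserving c \<E>"
    using assms by (auto simp: quantum_channel_def)
  have "psd (c * c) (density_of (max_ent c))"
    using psd_density_of[of "max_ent c"] by (simp add: max_ent_def)
  then have "psd (c * a) (tensor_map c c c a (\<lambda>Y. Y) \<E> (density_of (max_ent c)))"
    using cp by (simp add: completely_positive_def)
  then obtain B where B: "\<And>x y. x < c * a \<Longrightarrow> y < c * a \<Longrightarrow>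
      tensor_map c c c a (\<lambda>Y. Y) \<E> (density_of (max_ent c)) $$ (x, y) = (\<Sum>m<c * a. B m x * cnj (B m y))"
    using psd_rank_one_sum by metis
  \<comment> \<open>Row \<open>r * (c * a) + m\<close> pairs output index \<open>r\<close> with
    environment index \<open>m\<close>. Its entry in column \<open>i\<close> is entry
    \<open>(r, i)\<close> of the Kraus operator obtained by reshaping \<open>B m\<close>.\<close>
  define V where "V = mat (a * (c * a)) c (\<lambda>(x, i). B (x mod (c * a)) (i * a + x div (c * a)))"
  have V: "V $$ (r * (c * a) + m, i) = B m (i * a + r)" if "r < a" "m < c * a" "i < c" for r m i
    using that index_pair_less[of r a m "c * a"] by (simp add: V_def)
  have kraus: "\<E> (mat_unit c i j) $$ (r, s)
      = (\<Sum>m<c * a. V $$ (r * (c * a) + m, i) * cnj (V $$ (s * (c * a) + m, j)))"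
    if "i < c" "j < c" "r < a" "s < a" for i j r s
    using that choi_matrix_entry[OF E that] index_pair_less[of i c r a] index_pair_less[of j c s a]
    by (simp add: B V)
  \<comment> \<open>The inner product of columns \<open>i\<close> and \<open>j\<close> is the trace
    of the image of a matrix unit, so trace preservation gives orthonormality.\<close>
  have "(\<Sum>x<a * (c * a). V $$ (x, i) * cnj (V $$ (x, j))) = (if i = j then 1 else 0)"
    if ij: "i < c" "j < c" for i j
  proof -
    have u: "mat_unit c i j \<in> carrier_mat c c" by (simp add: mat_unit_def)
    then have "\<E> (mat_unit c i j) \<in> carrier_mat a a" using E by (simp add: linear_map_def)
    then have "(\<Sum>x<a * (c * a). V $$ (x, i) * cnj (V $$ (x, j))) = mat_trace (\<E> (mat_unit c i j))"
      using ij by (simp add: sum_lessThan_mult[of _ a] mat_trace_def kraus)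
    also have "\<dots> = mat_trace (mat_unit c i j)"
      using tp u by (simp add: trace_preserving_def)
    also have "\<dots> = (\<Sum>k<c. if k = i then if i = j then 1 else 0 else 0)"
      by (auto simp: mat_trace_def mat_unit_def intro!: sum.cong)
    finally show ?thesis using ij by simp
  qed
  then have "isometry c (a * (c * a)) V" by (simp add: isometry_iff V_def)
  with kraus show ?thesis by blast
qed

section \<open>Sequential compactness of isometries, and preservation of norms\<close>

text \<open>Bolzano-Weierstrass by induction: each new coordinate has a monotone subsequence along
  the one already chosen, and boundedness makes it converge.\<close>

lemma finite_family_convergent_subseq_real:
  fixes f :: "nat \<Rightarrow> 'i \<Rightarrow> real"
  assumes "finite I" and "\<And>n i. i \<in> I \<Longrightarrow> \<bar>f n i\<bar> \<le> B"
  shows "\<exists>r l. strict_mono r \<and> (\<forall>i\<in>I. (\<lambda>n. f (r n) i) \<longlonglongrightarrow> l i)"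
  using assms
proof (induction I rule: finite_induct)
  case empty
  then show ?case using strict_mono_id by blast
next
  case (insert x I)
  then obtain r l where r: "strict_mono r" "\<And>i. i \<in> I \<Longrightarrow> (\<lambda>n. f (r n) i) \<longlonglongrightarrow> l i"
    by fastforce
  obtain s where s: "strict_mono s" "monoseq (\<lambda>n. f (r (s n)) x)"
    using seq_monosub[of "\<lambda>n. f (r n) x"] by blast
  have "Bseq (\<lambda>n. f (r (s n)) x)"
    using insert.prems by (intro BseqI'[of _ B]) simp
  then obtain y where y: "(\<lambda>n. f (r (s n)) x) \<longlonglongrightarrow> y"
    using Bseq_monoseq_convergent[OF _ s(2)] by (auto simp: convergent_def)
  have "(\<lambda>n. f ((r \<circ> s) n) i) \<longlonglongrightarrow> (l(x := y)) i" if "i \<in> insert x I" for i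
    using that y LIMSEQ_subseq_LIMSEQ[OF r(2) s(1)] by (auto simp: o_def)
  moreover have "strict_mono (r \<circ> s)" using r(1) s(1) by (rule strict_mono_o)
  ultimately show ?case by blast
qed

text \<open>Real and imaginary parts form a real family indexed by \<open>I \<times> UNIV\<close>,
  with a Boolean selecting the part.\<close>

lemma finite_family_convergent_subseq:
  fixes f :: "nat \<Rightarrow> 'i \<Rightarrow> complex"
  assumes "finite I" and bound: "\<And>n i. i \<in> I \<Longrightarrow> cmod (f n i) \<le> B"
  shows "\<exists>r l. strict_mono r \<and> (\<forall>i\<in>I. (\<lambda>n. f (r n) i) \<longlonglongrightarrow> l i)"
proof -
  let ?g = "\<lambda>n (i, re). if re then Re (f n i) else Im (f n i)"
  have fin: "finite (I \<times> (UNIV :: bool set))" using assms(1) by simp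
  have bnd: "\<bar>?g n q\<bar> \<le> B" if "q \<in> I \<times> (UNIV :: bool set)" for n q
    using that order_trans[OF abs_Re_le_cmod bound] order_trans[OF abs_Im_le_cmod bound] by auto
  obtain r l where r: "strict_mono r"
    and l: "\<And>q. q \<in> I \<times> (UNIV :: bool set) \<Longrightarrow> (\<lambda>n. ?g (r n) q) \<longlonglongrightarrow> l q"
    using finite_family_convergent_subseq_real[where f = ?g, OF fin bnd] by blast
  have "(\<lambda>n. f (r n) i) \<longlonglongrightarrow> Complex (l (i, True)) (l (i, False))" if "i \<in> I" for i
    unfolding tendsto_complex_iff using l[of "(i, True)"] l[of "(i, False)"] that by simp
  then show ?thesis using r by (intro exI[of _ r] exI[of _ "\<lambda>i. Complex (l (i, True)) (l (i, False))"]) blast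
qed

text \<open>Columns are unit vectors. This supplies the uniform bound for extracting a
  subsequence.\<close>

lemma isometry_entry_le_1:
  assumes "isometry m n V" "x < n" "i < m"
  shows "cmod (V $$ (x, i)) \<le> 1"
proof -
  have "complex_of_real (\<Sum>y<n. (cmod (V $$ (y, i)))\<^sup>2) = 1"
    using assms by (simp add: isometry_iff complex_norm_square del: of_real_power)
  then have "(\<Sum>y<n. (cmod (V $$ (y, i)))\<^sup>2) = 1" by (simp only: of_real_eq_1_iff)
  then have "(cmod (V $$ (x, i)))\<^sup>2 \<le> 1"
    using assms member_le_sum[of x "{..<n}" "\<lambda>y. (cmod (V $$ (y, i)))\<^sup>2"] by simp
  then show ?thesis by (simp add: power_le_one_iff)
qed

text \<open>The entries are bounded, and the orthonormality equations are polynomial in the entries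
  and their conjugates, so they survive the limit.\<close>

lemma isometry_convergent_subseq:
  fixes V :: "nat \<Rightarrow> complex mat"
  assumes V: "\<And>k. isometry m n (V k)"
  shows "\<exists>r L. strict_mono r \<and> isometry m n L \<and>
    (\<forall>x<n. \<forall>i<m. (\<lambda>k. V (r k) $$ (x, i)) \<longlonglongrightarrow> L $$ (x, i))"
proof -
  obtain r l where r: "strict_mono r"
    and l: "\<And>q. q \<in> {..<n} \<times> {..<m} \<Longrightarrow> (\<lambda>k. V (r k) $$ q) \<longlonglongrightarrow> l q"
    using finite_family_convergent_subseq[of "{..<n} \<times> {..<m}" "\<lambda>k q. V k $$ q" 1]
      isometry_entry_le_1[OF V] by fastforce
  define L where "L = mat n m l"
  have L: "(\<lambda>k. V (r k) $$ (x, i)) \<longlonglongrightarrow> L $$ (x, i)" if "x < n" "i < m" for x i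
    using l[of "(x, i)"] that by (simp add: L_def)
  have "(\<Sum>x<n. L $$ (x, i) * cnj (L $$ (x, j))) = (if i = j then 1 else 0)" if "i < m" "j < m" for i j
  proof (rule LIMSEQ_unique)
    show "(\<lambda>k. \<Sum>x<n. V (r k) $$ (x, i) * cnj (V (r k) $$ (x, j)))
        \<longlonglongrightarrow> (\<Sum>x<n. L $$ (x, i) * cnj (L $$ (x, j)))"
      using L that by (intro tendsto_intros) auto
    show "(\<lambda>k. \<Sum>x<n. V (r k) $$ (x, i) * cnj (V (r k) $$ (x, j))) \<longlonglongrightarrow> (if i = j then 1 else 0)"
      using V that by (simp add: isometry_iff)
  qed
  then have "isometry m n L" by (simp add: isometry_iff L_def)
  with r L show ?thesis by blast
qed

text \<open>Stated for a coefficient function so that it applies to slices of a bipartite vector in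
  which the other index is fixed.\<close>

lemma isometry_norm:
  assumes V: "isometry m n V"
  shows "(\<Sum>x<n. (cmod (\<Sum>i<m. V $$ (x, i) * f i))\<^sup>2) = (\<Sum>i<m. (cmod (f i))\<^sup>2)"
proof -
  have "complex_of_real (\<Sum>x<n. (cmod (\<Sum>i<m. V $$ (x, i) * f i))\<^sup>2)
      = (\<Sum>x<n. \<Sum>i<m. \<Sum>j<m. f i * cnj (f j) * (V $$ (x, i) * cnj (V $$ (x, j))))"
    by (simp add: complex_norm_square sum_product ac_simps del: of_real_power)
  also have "\<dots> = (\<Sum>i<m. \<Sum>j<m. \<Sum>x<n. f i * cnj (f j) * (V $$ (x, i) * cnj (V $$ (x, j))))"
    by (subst sum.swap) (rule sum.cong[OF refl sum.swap])
  also have "\<dots> = (\<Sum>i<m. \<Sum>j<m. if j = i then f i * cnj (f i) else 0)"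
    using V by (intro sum.cong refl) (auto simp: isometry_iff simp flip: sum_distrib_left)
  also have "\<dots> = complex_of_real (\<Sum>i<m. (cmod (f i))\<^sup>2)"
    by (simp add: complex_norm_square del: of_real_power)
  finally show ?thesis by (simp only: of_real_eq_iff)
qed

section \<open>Fidelity of dilated states\<close>

text \<open>The component of \<open>(V \<otimes> W) \<phi>\<close> at the basis vector \<open>p\<close> of \<open>A B\<close> and the basis vector
  \<open>z\<close> of \<open>A' B'\<close>, where \<open>A'\<close> and \<open>B'\<close> have dimensions \<open>N\<close> and \<open>M\<close>, and its overlap with a
  target in \<open>A B\<close>.\<close>

definition dilated_amp :: "nat \<Rightarrow> nat \<Rightarrow> nat \<Rightarrow> nat \<Rightarrow> nat \<Rightarrow> complex mat \<Rightarrow> complex mat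
    \<Rightarrow> complex vec \<Rightarrow> nat \<times> nat \<Rightarrow> nat \<Rightarrow> complex" where
  "dilated_amp b c d N M V W \<phi> z p = (\<Sum>i<c. \<Sum>k<d.
     V $$ (p div b * N + fst z, i) * W $$ (p mod b * M + snd z, k) * \<phi> $ (i * d + k))"

definition overlap_amp :: "nat \<Rightarrow> complex vec \<Rightarrow> (nat \<Rightarrow> complex) \<Rightarrow> complex" where
  "overlap_amp n \<psi> u = (\<Sum>p<n. u p * cnj (\<psi> $ p))"

lemma sum_swap_inward2:
  "(\<Sum>z\<in>P. \<Sum>i\<in>A. \<Sum>j\<in>B. T z i j) = (\<Sum>i\<in>A. \<Sum>j\<in>B. \<Sum>z\<in>P. T z i j)"
  by (subst sum.swap) (rule sum.cong[OF refl sum.swap])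

lemma sum_swap_inward4:
  "(\<Sum>z\<in>P. \<Sum>i\<in>A. \<Sum>j\<in>B. \<Sum>k\<in>C. \<Sum>l\<in>D. T z i j k l)
    = (\<Sum>i\<in>A. \<Sum>j\<in>B. \<Sum>k\<in>C. \<Sum>l\<in>D. \<Sum>z\<in>P. T z i j k l)"
  unfolding sum_swap_inward2[where P = P and A = A and B = B] sum_swap_inward2[where P = P and A = C and B = D] ..

text \<open>These amplitudes are the entries of \<open>(V \<otimes> W) \<phi>\<close> in another
  order, and local isometries preserve the norm.\<close>

lemma dilated_amp_norm:
  assumes V: "isometry c (a * N) V" and W: "isometry d (b * M) W"
    and \<phi>: "bipartite_pure_state c d \<phi>"
  shows "(\<Sum>z\<in>{..<N} \<times> {..<M}. \<Sum>p<a * b. (cmod (dilated_amp b c d N M V W \<phi> z p))\<^sup>2) = 1"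
proof -
  define g where "g = (\<lambda>x y. (cmod (\<Sum>i<c. V $$ (x, i) * (\<Sum>k<d. W $$ (y, k) * \<phi> $ (i * d + k))))\<^sup>2)"
  have "(\<Sum>z\<in>{..<N} \<times> {..<M}. \<Sum>p<a * b. (cmod (dilated_amp b c d N M V W \<phi> z p))\<^sup>2)
      = (\<Sum>m<N. \<Sum>n<M. \<Sum>r<a. \<Sum>s<b. g (r * N + m) (s * M + n))"
    by (simp add: sum.cartesian_product' sum_lessThan_mult dilated_amp_def g_def sum_distrib_left mult.assoc)
  \<comment> \<open>Each system index is brought next to its own environment index, which
    reassembles the rows of \<open>V\<close> and of \<open>W\<close>. The two isometries can then be
    removed in turn.\<close>
  also have "\<dots> = (\<Sum>r<a. \<Sum>m<N. \<Sum>s<b. \<Sum>n<M. g (r * N + m) (s * M + n))"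
    by (simp only: sum_swap_inward2[of _ "{..<a}"] sum.swap[of _ "{..<a}"] sum.swap[of _ "{..<b}" "{..<M}"])
  also have "\<dots> = (\<Sum>y<b * M. \<Sum>x<a * N. g x y)"
    by (subst sum.swap) (simp only: sum_lessThan_mult)
  also have "\<dots> = (\<Sum>y<b * M. \<Sum>i<c. (cmod (\<Sum>k<d. W $$ (y, k) * \<phi> $ (i * d + k)))\<^sup>2)"
    unfolding g_def isometry_norm[OF V] ..
  also have "\<dots> = (\<Sum>i<c. \<Sum>k<d. (cmod (\<phi> $ (i * d + k)))\<^sup>2)"
    by (subst sum.swap) (simp only: isometry_norm[OF W])
  also have "\<dots> = (\<Sum>t<c * d. (cmod (\<phi> $ t))\<^sup>2)"
    by (simp only: sum_lessThan_mult)
  also have "complex_of_real \<dots> = \<phi> \<bullet>c \<phi>"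
    using \<phi> by (auto simp: bipartite_pure_state_def scalar_prod_def atLeast0LessThan complex_norm_square
        simp del: of_real_power)
  also have "\<phi> \<bullet>c \<phi> = 1" using \<phi> by (simp add: bipartite_pure_state_def)
  finally show ?thesis by (simp only: of_real_eq_1_iff)
qed

text \<open>The output state is the partial trace of the dilated pure state over the environments,
  hence a sum of rank-one terms over the environment basis \<open>z\<close>.\<close>

lemma tensor_map_density_entry:
  assumes kE: "\<And>i j r s. i < c \<Longrightarrow> j < c \<Longrightarrow> r < a \<Longrightarrow> s < a \<Longrightarrow> \<E> (mat_unit c i j) $$ (r, s)
      = (\<Sum>m<N. V $$ (r * N + m, i) * cnj (V $$ (s * N + m, j)))"
    and kF: "\<And>k l r s. k < d \<Longrightarrow> l < d \<Longrightarrow> r < b \<Longrightarrow> s < b \<Longrightarrow> \<F> (mat_unit d k l) $$ (r, s)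
      = (\<Sum>n<M. W $$ (r * M + n, k) * cnj (W $$ (s * M + n, l)))"
    and E: "linear_map c a \<E>" and F: "linear_map d b \<F>"
    and \<phi>: "\<phi> \<in> carrier_vec (c * d)" and pq: "p < a * b" "q < a * b"
  shows "tensor_map c a d b \<E> \<F> (density_of \<phi>) $$ (p, q)
    = (\<Sum>z\<in>{..<N} \<times> {..<M}. dilated_amp b c d N M V W \<phi> z p * cnj (dilated_amp b c d N M V W \<phi> z q))"
proof -
  define K where "K = (\<lambda>p z i k. V $$ (p div b * N + fst z, i) * W $$ (p mod b * M + snd z, k) * \<phi> $ (i * d + k))"
  have dens: "density_of \<phi> $$ (i * d + k, j * d + l) = \<phi> $ (i * d + k) * cnj (\<phi> $ (j * d + l))"
    if "i < c" "k < d" "j < c" "l < d" for i j k l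
    using \<phi> that index_pair_less[of i c k d] index_pair_less[of j c l d] by (simp add: density_of_def)
  have unit: "tensor_mat (\<E> (mat_unit c i j)) (\<F> (mat_unit d k l)) $$ (p, q)
      = (\<Sum>m<N. V $$ (p div b * N + m, i) * cnj (V $$ (q div b * N + m, j)))
        * (\<Sum>n<M. W $$ (p mod b * M + n, k) * cnj (W $$ (q mod b * M + n, l)))"
    if "i < c" "k < d" "j < c" "l < d" for i j k l
  proof -
    have "\<E> (mat_unit c i j) \<in> carrier_mat a a" "\<F> (mat_unit d k l) \<in> carrier_mat b b"
      using E F by (auto simp: linear_map_def mat_unit_def)
    then show ?thesis
      using that pq by (auto simp: tensor_mat_def index_div_less index_mod_less kE kF)
  qed
  have "tensor_map c a d b \<E> \<F> (density_of \<phi>) $$ (p, q)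
      = (\<Sum>i<c. \<Sum>j<c. \<Sum>k<d. \<Sum>l<d. density_of \<phi> $$ (i * d + k, j * d + l)
          * tensor_mat (\<E> (mat_unit c i j)) (\<F> (mat_unit d k l)) $$ (p, q))"
    using pq by (simp add: tensor_map_def)
  also have "\<dots> = (\<Sum>i<c. \<Sum>j<c. \<Sum>k<d. \<Sum>l<d. \<Sum>z\<in>{..<N} \<times> {..<M}. K p z i k * cnj (K q z j l))"
  proof (intro sum.cong refl)
    fix i j k l assume "i \<in> {..<c}" "j \<in> {..<c}" "k \<in> {..<d}" "l \<in> {..<d}"
    then show "density_of \<phi> $$ (i * d + k, j * d + l) * tensor_mat (\<E> (mat_unit c i j)) (\<F> (mat_unit d k l)) $$ (p, q)
        = (\<Sum>z\<in>{..<N} \<times> {..<M}. K p z i k * cnj (K q z j l))"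
      by (simp only: lessThan_iff dens unit sum_product)
        (simp add: K_def sum_distrib_left sum.cartesian_product' ac_simps)
  qed
  also have "\<dots> = (\<Sum>z\<in>{..<N} \<times> {..<M}. \<Sum>i<c. \<Sum>j<c. \<Sum>k<d. \<Sum>l<d. K p z i k * cnj (K q z j l))"
    by (rule sum_swap_inward4[symmetric])
  also have "\<dots> = (\<Sum>z\<in>{..<N} \<times> {..<M}. dilated_amp b c d N M V W \<phi> z p * cnj (dilated_amp b c d N M V W \<phi> z q))"
    by (simp only: dilated_amp_def K_def cnj_sum sum_product)
  finally show ?thesis .
qed

text \<open>Each rank-one term contributes the squared modulus of its inner product with
  \<open>\<psi>\<close>.\<close>

lemma pure_fidelity_rank_one_sum:
  assumes "\<sigma> \<in> carrier_mat n n" and "\<psi> \<in> carrier_vec n"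
    and entry: "\<And>p q. p < n \<Longrightarrow> q < n \<Longrightarrow> \<sigma> $$ (p, q) = (\<Sum>z\<in>P. u z p * cnj (u z q))"
  shows "pure_fidelity \<psi> \<sigma> = (\<Sum>z\<in>P. (cmod (overlap_amp n \<psi> (u z)))\<^sup>2)"
proof -
  have "(\<sigma> *\<^sub>v \<psi>) \<bullet>c \<psi> = (\<Sum>p<n. \<Sum>q<n. \<Sum>z\<in>P. u z p * cnj (\<psi> $ p) * cnj (u z q * cnj (\<psi> $ q)))"
    using assms by (simp add: scalar_prod_def atLeast0LessThan sum_distrib_left sum_distrib_right entry ac_simps)
  also have "\<dots> = (\<Sum>z\<in>P. \<Sum>p<n. \<Sum>q<n. u z p * cnj (\<psi> $ p) * cnj (u z q * cnj (\<psi> $ q)))"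
    by (rule sum_swap_inward2[symmetric])
  also have "\<dots> = (\<Sum>z\<in>P. overlap_amp n \<psi> (u z) * cnj (overlap_amp n \<psi> (u z)))"
    by (simp only: overlap_amp_def cnj_sum sum_product)
  also have "\<dots> = complex_of_real (\<Sum>z\<in>P. (cmod (overlap_amp n \<psi> (u z)))\<^sup>2)"
    by (simp add: complex_norm_square del: of_real_power)
  finally show ?thesis by (simp only: pure_fidelity_def Re_complex_of_real)
qed

section \<open>Fidelity one and product form\<close>

text \<open>Pythagoras for the orthogonal projection onto the unit vector
  \<open>\<psi>\<close>.\<close>

lemma overlap_residual_norm:
  assumes "\<psi> \<in> carrier_vec n" "\<psi> \<bullet>c \<psi> = 1"
  shows "(\<Sum>p<n. (cmod (u p - overlap_amp n \<psi> u * \<psi> $ p))\<^sup>2)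
    = (\<Sum>p<n. (cmod (u p))\<^sup>2) - (cmod (overlap_amp n \<psi> u))\<^sup>2"
proof -
  define o' where "o' = overlap_amp n \<psi> u"
  have one: "(\<Sum>p<n. \<psi> $ p * cnj (\<psi> $ p)) = 1"
    using assms by (simp add: scalar_prod_def atLeast0LessThan)
  have ov: "(\<Sum>p<n. u p * cnj (\<psi> $ p)) = o'" by (simp add: o'_def overlap_amp_def)
  have co: "cnj o' = (\<Sum>p<n. \<psi> $ p * cnj (u p))"
    by (simp add: o'_def overlap_amp_def mult.commute)
  have "complex_of_real (\<Sum>p<n. (cmod (u p - o' * \<psi> $ p))\<^sup>2)
      = (\<Sum>p<n. u p * cnj (u p) - cnj o' * (u p * cnj (\<psi> $ p)) - o' * (\<psi> $ p * cnj (u p))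
          + o' * cnj o' * (\<psi> $ p * cnj (\<psi> $ p)))"
    by (simp add: complex_norm_square algebra_simps del: of_real_power)
  also have "\<dots> = (\<Sum>p<n. u p * cnj (u p)) - cnj o' * o' - o' * cnj o' + o' * cnj o' * 1"
    unfolding sum.distrib sum_subtractf sum_distrib_left[symmetric] one ov co[symmetric] ..
  also have "\<dots> = complex_of_real ((\<Sum>p<n. (cmod (u p))\<^sup>2) - (cmod o')\<^sup>2)"
    by (simp add: complex_norm_square mult.commute del: of_real_power)
  finally show ?thesis by (simp only: of_real_eq_iff o'_def)
qed

text \<open>The squared residuals add up to 1 minus the total squared overlap, which is at most 0,
  so every residual vanishes.\<close>

lemma max_overlap_parallel:
  assumes "finite P" and \<psi>: "\<psi> \<in> carrier_vec n" "\<psi> \<bullet>c \<psi> = 1"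
    and norm: "(\<Sum>z\<in>P. \<Sum>p<n. (cmod (u z p))\<^sup>2) = 1"
    and ge: "1 \<le> (\<Sum>z\<in>P. (cmod (overlap_amp n \<psi> (u z)))\<^sup>2)"
  shows "(\<Sum>z\<in>P. (cmod (overlap_amp n \<psi> (u z)))\<^sup>2) = 1"
    and "\<And>z p. z \<in> P \<Longrightarrow> p < n \<Longrightarrow> u z p = overlap_amp n \<psi> (u z) * \<psi> $ p"
proof -
  let ?D = "\<lambda>z. \<Sum>p<n. (cmod (u z p - overlap_amp n \<psi> (u z) * \<psi> $ p))\<^sup>2"
  have D0: "0 \<le> ?D z" for z by (intro sum_nonneg) simp
  have D: "(\<Sum>z\<in>P. ?D z) = 1 - (\<Sum>z\<in>P. (cmod (overlap_amp n \<psi> (u z)))\<^sup>2)"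
    by (simp only: overlap_residual_norm[OF \<psi>] sum_subtractf norm)
  moreover have "0 \<le> (\<Sum>z\<in>P. ?D z)" by (intro sum_nonneg D0)
  ultimately show "(\<Sum>z\<in>P. (cmod (overlap_amp n \<psi> (u z)))\<^sup>2) = 1" using ge by linarith
  with D have "(\<Sum>z\<in>P. ?D z) = 0" by simp
  then have "?D z = 0" if "z \<in> P" for z
    using that assms(1) D0 by (simp add: sum_nonneg_eq_0_iff)
  then show "u z p = overlap_amp n \<psi> (u z) * \<psi> $ p" if "z \<in> P" "p < n" for z p
    using that by (simp add: sum_nonneg_eq_0_iff)
qed

text \<open>Amplitudes that factor into an environment part and \<open>\<psi>\<close> exhibit the
  dilated seed as a product, with \<open>\<zeta>\<close> holding the coefficients of the leftover
  state.\<close>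

lemma locally_containsI:
  assumes V: "isometry c (a * N) V" and W: "isometry d (b * M) W"
    and \<phi>: "bipartite_pure_state c d \<phi>"
    and norm: "(\<Sum>z\<in>{..<N} \<times> {..<M}. (cmod (\<zeta> z))\<^sup>2) = 1"
    and amp: "\<And>z p. z \<in> {..<N} \<times> {..<M} \<Longrightarrow> p < a * b \<Longrightarrow>
      dilated_amp b c d N M V W \<phi> z p = \<zeta> z * \<psi> $ p"
  shows "locally_contains c d \<phi> a b \<psi>"
proof -
  define \<xi> where "\<xi> = vec (N * M) (\<lambda>t. \<zeta> (t div M, t mod M))"
  have carr: "V \<in> carrier_mat (a * N) c" "W \<in> carrier_mat (b * M) d" "\<phi> \<in> carrier_vec (c * d)"
    using V W \<phi> by (auto simp: isometry_def bipartite_pure_state_def)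
  have \<xi>: "\<xi> $ (m * M + n) = \<zeta> (m, n)" if "m < N" "n < M" for m n
    using that index_pair_less[of m N n M] by (simp add: \<xi>_def)
  have "\<xi> \<bullet>c \<xi> = (\<Sum>t<N * M. \<xi> $ t * cnj (\<xi> $ t))"
    by (simp add: \<xi>_def scalar_prod_def atLeast0LessThan)
  also have "\<dots> = (\<Sum>m<N. \<Sum>n<M. \<xi> $ (m * M + n) * cnj (\<xi> $ (m * M + n)))"
    by (rule sum_lessThan_mult)
  also have "\<dots> = complex_of_real (\<Sum>z\<in>{..<N} \<times> {..<M}. (cmod (\<zeta> z))\<^sup>2)"
    by (simp add: \<xi> sum.cartesian_product' complex_norm_square del: of_real_power)
  finally have "bipartite_pure_state N M \<xi>"
    unfolding norm by (simp add: bipartite_pure_state_def \<xi>_def)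
  moreover have "tensor_mat V W *\<^sub>v \<phi> = bipartite_tensor a b N M \<psi> \<xi>"
  proof (rule eq_vecI)
    show "dim_vec (tensor_mat V W *\<^sub>v \<phi>) = dim_vec (bipartite_tensor a b N M \<psi> \<xi>)"
      using carr by (simp add: tensor_mat_def bipartite_tensor_def)
    fix t assume "t < dim_vec (bipartite_tensor a b N M \<psi> \<xi>)"
    then have t: "t < (a * N) * (b * M)" by (simp add: bipartite_tensor_def)
    define x y where xy: "x = t div (b * M)" "y = t mod (b * M)"
    have x: "x < a * N" and y: "y < b * M"
      using t index_div_less index_mod_less unfolding xy by blast+
    note l = index_div_less[OF x] index_mod_less[OF x] index_div_less[OF y] index_mod_less[OF y]
    \<comment> \<open>The system parts of the two row indices combine to an index of
      \<open>A B\<close>. The environment parts \<open>x mod N\<close> and \<open>y mod M\<close>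
      form the matching \<open>z\<close>.\<close>
    define p where "p = x div N * b + y div M"
    have p: "p < a * b" "p div b = x div N" "p mod b = y div M"
      unfolding p_def using l(1,3) index_pair_less by auto
    have "(tensor_mat V W *\<^sub>v \<phi>) $ t = (\<Sum>i<c. \<Sum>k<d. V $$ (x, i) * W $$ (y, k) * \<phi> $ (i * d + k))"
      using carr t index_pair_less[of _ c _ d]
      by (simp add: tensor_mat_def scalar_prod_def atLeast0LessThan sum_lessThan_mult flip: xy)
    also have "\<dots> = dilated_amp b c d N M V W \<phi> (x mod N, y mod M) p"
      by (simp add: dilated_amp_def p)
    also have "\<dots> = \<xi> $ (x mod N * M + y mod M) * \<psi> $ p"
      using l p(1) by (simp add: amp \<xi>)
    also have "\<dots> = bipartite_tensor a b N M \<psi> \<xi> $ t"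
      using t by (simp add: bipartite_tensor_def Let_def p_def flip: xy)
    finally show "(tensor_mat V W *\<^sub>v \<phi>) $ t = bipartite_tensor a b N M \<psi> \<xi> $ t" .
  qed
  ultimately show ?thesis using V W unfolding locally_contains_def by blast
qed

theorem theorem6:
  fixes a b c d :: nat and \<psi> \<phi> :: "complex vec"
  assumes target: "bipartite_pure_state a b \<psi>"
    and seed: "bipartite_pure_state c d \<phi>"
    and not_contained: "\<not> locally_contains c d \<phi> a b \<psi>"
  shows "\<exists>\<epsilon>::real. \<epsilon> > 0 \<and>
    \<not> (\<exists>\<E> \<F>. quantum_channel c a \<E> \<and> quantum_channel d b \<F> \<and>
          pure_fidelity \<psi> (tensor_map c a d b \<E> \<F> (density_of \<phi>)) \<ge> 1 - \<epsilon>)"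
proof (rule ccontr)
  assume none: "\<not> ?thesis"
  \<comment> \<open>The environment dimensions of the dilations depend only on the dimensions of the
    spaces, so the isometries for all error levels lie in one compact set.\<close>
  define N M where "N = c * a" and "M = d * b"
  define fid where "fid = (\<lambda>V W. \<Sum>z\<in>{..<N} \<times> {..<M}.
    (cmod (overlap_amp (a * b) \<psi> (dilated_amp b c d N M V W \<phi> z)))\<^sup>2)"
  have \<psi>: "\<psi> \<in> carrier_vec (a * b)" "\<psi> \<bullet>c \<psi> = 1" and \<phi>: "\<phi> \<in> carrier_vec (c * d)"
    using target seed by (auto simp: bipartite_pure_state_def)
  have "\<exists>V W. isometry c (a * N) V \<and> isometry d (b * M) W \<and> 1 - 1 / real (Suc k) \<le> fid V W" for k
  proof -
    have "1 / real (Suc k) > 0" by simp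
    with none obtain \<E> \<F> where E: "quantum_channel c a \<E>" and F: "quantum_channel d b \<F>"
      and ge: "pure_fidelity \<psi> (tensor_map c a d b \<E> \<F> (density_of \<phi>)) \<ge> 1 - 1 / real (Suc k)"
      by blast
    obtain V where V: "isometry c (a * N) V" and kE: "\<And>i j r s. i < c \<Longrightarrow> j < c \<Longrightarrow> r < a \<Longrightarrow> s < a \<Longrightarrow>
        \<E> (mat_unit c i j) $$ (r, s) = (\<Sum>m<N. V $$ (r * N + m, i) * cnj (V $$ (s * N + m, j)))"
      using quantum_channel_dilation[OF E] unfolding N_def by blast
    obtain W where W: "isometry d (b * M) W" and kF: "\<And>i j r s. i < d \<Longrightarrow> j < d \<Longrightarrow> r < b \<Longrightarrow> s < b \<Longrightarrow>
        \<F> (mat_unit d i j) $$ (r, s) = (\<Sum>n<M. W $$ (r * M + n, i) * cnj (W $$ (s * M + n, j)))"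
      using quantum_channel_dilation[OF F] unfolding M_def by blast
    have lin: "linear_map c a \<E>" "linear_map d b \<F>"
      using E F by (simp_all add: quantum_channel_def)
    have "pure_fidelity \<psi> (tensor_map c a d b \<E> \<F> (density_of \<phi>)) = fid V W"
      unfolding fid_def
      by (intro pure_fidelity_rank_one_sum \<psi>(1) tensor_map_density_entry kE kF lin \<phi>)
        (simp add: tensor_map_def)
    then show ?thesis using V W ge by metis
  qed
  then obtain V W where VW: "\<And>k. isometry c (a * N) (V k)" "\<And>k. isometry d (b * M) (W k)"
    and ge: "\<And>k. 1 - 1 / real (Suc k) \<le> fid (V k) (W k)"
    by metis
  obtain r V' where r: "strict_mono r" and V': "isometry c (a * N) V'"
    and V_lim: "\<And>x i. x < a * N \<Longrightarrow> i < c \<Longrightarrow> (\<lambda>k. V (r k) $$ (x, i)) \<longlonglongrightarrow> V' $$ (x, i)"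
    using isometry_convergent_subseq[of c "a * N" V, OF VW(1)] by blast
  \<comment> \<open>Extracting from the subsequence \<open>r\<close> already chosen lets both
    families converge along \<open>r (s k)\<close>.\<close>
  obtain s W' where s: "strict_mono s" and W': "isometry d (b * M) W'"
    and W_lim: "\<And>x i. x < b * M \<Longrightarrow> i < d \<Longrightarrow> (\<lambda>k. W (r (s k)) $$ (x, i)) \<longlonglongrightarrow> W' $$ (x, i)"
    using isometry_convergent_subseq[of d "b * M" "\<lambda>k. W (r k)", OF VW(2)] by blast
  have V_lim': "(\<lambda>k. V (r (s k)) $$ (x, i)) \<longlonglongrightarrow> V' $$ (x, i)" if "x < a * N" "i < c" for x i
    using LIMSEQ_subseq_LIMSEQ[OF V_lim[OF that] s] by (simp add: o_def)
  \<comment> \<open>\<open>fid\<close> is continuous: it is built from the finitely many entries by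
    sums, products and squared moduli.\<close>
  have fid_lim: "(\<lambda>k. fid (V (r (s k))) (W (r (s k)))) \<longlonglongrightarrow> fid V' W'"
    unfolding fid_def overlap_amp_def dilated_amp_def
    by (intro tendsto_intros V_lim' W_lim) (auto intro!: index_pair_less simp: index_div_less index_mod_less)
  have "(\<lambda>k. 1 - 1 / real (Suc k)) \<longlonglongrightarrow> 1"
    using LIMSEQ_inverse_real_of_nat_add_minus[of 1] by (simp add: inverse_eq_divide)
  then have "1 \<le> fid V' W'"
  proof (rule LIMSEQ_le[OF _ fid_lim])
    have "1 - 1 / real (Suc k) \<le> fid (V (r (s k))) (W (r (s k)))" for k
    proof -
      \<comment> \<open>A strictly increasing index map never falls behind \<open>k\<close>, so the
        bound for index \<open>r (s k)\<close> is at least as strong as the one for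
        \<open>k\<close>.\<close>
      have "k \<le> r (s k)" using seq_suble[OF s, of k] seq_suble[OF r, of "s k"] by linarith
      then have "1 / real (Suc (r (s k))) \<le> 1 / real (Suc k)" by (intro divide_left_mono) auto
      then show ?thesis using ge[of "r (s k)"] by linarith
    qed
    then show "\<exists>n. \<forall>k\<ge>n. 1 - 1 / real (Suc k) \<le> fid (V (r (s k))) (W (r (s k)))" by blast
  qed
  note parallel = max_overlap_parallel[OF _ \<psi> dilated_amp_norm[OF V' W' seed] this[unfolded fid_def]]
  \<comment> \<open>The coefficients of the leftover state are the overlaps of the limiting
    amplitudes with \<open>\<psi>\<close>, and their squared moduli sum to 1 by
    \<open>parallel(1)\<close>.\<close>
  have "locally_contains c d \<phi> a b \<psi>"
    by (rule locally_containsI[OF V' W' seed parallel(1)]) (auto intro!: parallel(2))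
  then show False using not_contained by contradiction
qed

end
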